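(* Let $X$ and $Y$ be Banach spaces, let $p\ge 1$, $\ell\in Y$, and let $T:X\to Y$ be a linear operator for which there are constants $C_T>0$ and $\alpha>0$ with $$\|Tv\|_Y\le C_T\|v\|_X\quad\text{and}\quad \alpha\|v\|_X\le\|Tv\|_Y\qquad\forall v\in X .$$ Assume that the problem $Tu=\ell$ admits a unique solution $u\in X$, and set $\mathscr{J}(v)=\|Tv-\ell\|_Y^p$ for $v\in X$. Let $\mathcal{N}\subset X$ be a nonempty set with closure $\operatorname{cl}(\mathcal{N})$ in $X$, let $\tilde{\mathscr{J}}:\operatorname{cl}(\mathcal{N})\to\mathbb{R}$ be an approximate loss functional, and let $0\le\varepsilon_{\mathrm{rel}}<1$ and $\varepsilon_{\mathrm{opt}}\ge 0$. Let $\mathcal{M}(\tilde{\mathscr{J}})$ be the set of minimisers of $\tilde{\mathscr{J}}$ over $\operatorname{cl}(\mathcal{N})$ (assumed nonempty). Assume that $$|\mathscr{J}(v)-\tilde{\mathscr{J}}(v)|\le\varepsilon_{\mathrm{rel}}\,\mathscr{J}(v)\qquad\forall v\in\mathcal{N},$$ and that $\tilde u\in\mathcal{N}$ (the output of the optimisation algorithm) satisfies $$\min_{v\in\mathcal{M}(\tilde{\mathscr{J}})}|\tilde{\mathscr{J}}(\tilde u)-\tilde{\mathscr{J}}(v)|\le\varepsilon_{\mathrm{opt}} .$$ Then $$\|\tilde u-u\|_X\le\frac1\alpha\left(\frac{1}{1-\varepsilon_{\mathrm{rel}}}\Big((1+\varepsilon_{\mathrm{rel}})\inf_{w\in\operatorname{cl}(\mathcal{N})}\mathscr{J}(w)+\varepsilon_{\mathrm{opt}}\Big)\right)^{1/p}$$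 and $$\frac1\alpha\left(\frac{1}{1-\varepsilon_{\mathrm{rel}}}\Big((1+\varepsilon_{\mathrm{rel}})\inf_{w\in\operatorname{cl}(\mathcal{N})}\mathscr{J}(w)+\varepsilon_{\mathrm{opt}}\Big)\right)^{1/p}\le\frac1\alpha\left(\frac{1}{1-\varepsilon_{\mathrm{rel}}}\Big(C_T^p(1+\varepsilon_{\mathrm{rel}})\inf_{w\in\operatorname{cl}(\mathcal{N})}\|u-w\|_X^p+\varepsilon_{\mathrm{opt}}\Big)\right)^{1/p}.$$
   Context: In the application, $\mathcal{N}$ is the set of functions in $X$ realised by a neural network of a fixed architecture; it is in general neither convex nor closed. The number $\varepsilon_{\mathrm{rel}}$ is the relative perturbation (quadrature) error and $\varepsilon_{\mathrm{opt}}$ is the optimisation error. The element $\tilde u$ is only assumed to satisfy the displayed optimisation-error condition. *)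

theory Defs
  imports "HOL-Analysis.Analysis"
begin

definition residual_loss :: "('a \<Rightarrow> 'b::real_normed_vector) \<Rightarrow> 'b \<Rightarrow> real \<Rightarrow> 'a \<Rightarrow> real"
  where "residual_loss T l p v = norm (T v - l) powr p"

definition minimisers :: "('a \<Rightarrow> real) \<Rightarrow> 'a set \<Rightarrow> 'a set"
  where "minimisers f S = {v. is_arg_min f (\<lambda>x. x \<in> S) v}"

text \<open>
  The set of minimisers may be infinite, but all minimisers share one value of the functional. So a
  quantity that depends on a minimiser only through that value takes a single value, and
  \<^const>\<open>Min\<close>, which is meaningful only for finite nonempty sets, is its genuine minimum.
\<close>

lemma finite_minimisers_image: "finite ((\<lambda>v. g (f v)) ` minimisers f S)"
proof (cases "minimisers f S = {}")
  case False
  then obtain v where v: "v \<in> minimisers f S" by blast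
  have "f w = f v" if "w \<in> minimisers f S" for w
    using v that unfolding minimisers_def is_arg_min_linorder by (simp add: antisym)
  then have "(\<lambda>v. g (f v)) ` minimisers f S \<subseteq> {g (f v)}" by auto
  then show ?thesis using finite_subset by blast
qed simp

end

theory Submission
  imports Defs
begin

text \<open>
  Since \<^term>\<open>T u = l\<close>, linearity turns the residual into the error,
  \<^term>\<open>T v - l = T (v - u)\<close>, so the loss of any \<^term>\<open>v\<close> lies between the \<open>p\<close>-th powers of
  \<open>\<alpha>\<close> and of \<open>C_T\<close> times its distance to \<^term>\<open>u\<close> (lemmas \<open>residual_loss_ge_error\<close> and
  \<open>residual_loss_le_error\<close>). The upper bound, taken over \<open>cl N\<close>, gives the second inequality. By the
  lower bound, the first one follows once the loss of the computed element \<open>u_t\<close> is bounded by the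
  infimum of the loss (lemma \<open>quasi_optimal_loss\<close>).

  If \<open>v\<close> minimises the approximate loss over \<open>cl N\<close>, then for every \<open>w\<close> in \<open>N\<close>
  \<open>(1 - \<epsilon>_rel) * J u_t \<le> J_t u_t \<le> J_t v + \<epsilon>_opt \<le> J_t w + \<epsilon>_opt \<le> (1 + \<epsilon>_rel) * J w + \<epsilon>_opt\<close>,
  where \<open>J\<close> is the exact loss.
  The comparison of the exact and the approximate loss is available on \<open>N\<close> only, and the minimiser
  \<open>v\<close> may lie outside \<open>N\<close>; the chain compares the two losses only at \<open>u_t\<close> and at \<open>w\<close>, both in
  \<open>N\<close>. The exact loss is continuous, so its lower bounds on \<open>N\<close> persist on \<open>cl N\<close>, and
  \<open>J w\<close> in the last term may be replaced by the infimum over \<open>cl N\<close>.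
\<close>

lemma residual_eq_image_of_error:
  assumes "linear T" and "T u = l"
  shows "T v - l = T (v - u)"
  using assms by (simp add: linear_diff)

lemma residual_loss_ge_error:
  fixes p \<alpha> :: real
  assumes "linear T" and "T u = l" and "\<And>v. \<alpha> * norm v \<le> norm (T v)"
    and "\<alpha> \<ge> 0" and "p \<ge> 0"
  shows "(\<alpha> * norm (v - u)) powr p \<le> residual_loss T l p v"
  unfolding residual_loss_def residual_eq_image_of_error[OF assms(1,2)]
  using assms(3-5) by (intro powr_mono2) auto

lemma residual_loss_le_error:
  fixes p C :: real
  assumes "linear T" and "T u = l" and "\<And>v. norm (T v) \<le> C * norm v"
    and "C \<ge> 0" and "p \<ge> 0"
  shows "residual_loss T l p v \<le> C powr p * norm (u - v) powr p"
proof -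
  have "residual_loss T l p v \<le> (C * norm (v - u)) powr p"
    unfolding residual_loss_def residual_eq_image_of_error[OF assms(1,2)]
    using assms(3-5) by (intro powr_mono2) auto
  also have "\<dots> = C powr p * norm (u - v) powr p"
    using assms(4) by (simp add: powr_mult norm_minus_commute)
  finally show ?thesis .
qed

text \<open>
  Strict positivity of the exponent is essential: \<^term>\<open>x powr 0\<close> is \<open>1\<close> except at \<open>x = 0\<close>, where it
  is \<open>0\<close>, so the loss with exponent zero can jump at solutions of \<^term>\<open>T x = l\<close>.
\<close>

lemma continuous_on_residual_loss:
  fixes p :: real
  assumes "bounded_linear T" and "p > 0"
  shows "continuous_on S (residual_loss T l p)"
  unfolding residual_loss_def
  using assms by (intro continuous_on_powr' continuous_intros linear_continuous_on) auto

lemma le_cINF_closure: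
  fixes f :: "'a::topological_space \<Rightarrow> real"
  assumes "continuous_on UNIV f" and "N \<noteq> {}" and "\<And>w. w \<in> N \<Longrightarrow> c \<le> f w"
  shows "c \<le> (INF w\<in>closure N. f w)"
proof (rule cINF_greatest)
  have "closure N \<subseteq> {w. c \<le> f w}"
    using assms by (intro closure_minimal closed_Collect_le continuous_on_const) auto
  then show "c \<le> f w" if "w \<in> closure N" for w using that by blast
qed (use assms(2) in simp)

text \<open>
  The absolute gap depends on a minimiser only through the minimal value, so the minimum over the
  possibly infinite set of minimisers is attained and any minimiser attaining it certifies that
  \<open>x\<close> is almost optimal.
\<close>

lemma near_optimal_if_Min_gap_le:
  fixes f :: "'a \<Rightarrow> real"
  assumes "minimisers f S \<noteq> {}" and "(MIN v\<in>minimisers f S. \<bar>f x - f v\<bar>) \<le> e" and "w \<in> S"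
  shows "f x \<le> f w + e"
proof -
  have "(MIN v\<in>minimisers f S. \<bar>f x - f v\<bar>) \<in> (\<lambda>v. \<bar>f x - f v\<bar>) ` minimisers f S"
    using assms(1) finite_minimisers_image[of "\<lambda>t. \<bar>f x - t\<bar>"] by (intro Min_in) auto
  then obtain v where v: "v \<in> minimisers f S" "\<bar>f x - f v\<bar> \<le> e"
    using assms(2) by auto
  then have "f v \<le> f w"
    using assms(3) unfolding minimisers_def is_arg_min_linorder by simp
  then show ?thesis using v(2) by linarith
qed

text \<open>
  A Cea-type estimate for inexact minimisation: the perturbation is relative to \<open>f\<close> itself, so it
  costs the factors \<open>1 - d\<close> at \<open>x\<close> and \<open>1 + d\<close> at the competitor. The competitor ranges over \<open>N\<close>, where
  the perturbation is controlled; continuity of \<open>f\<close> then recovers the infimum over \<open>closure N\<close>.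
\<close>

lemma quasi_optimal_loss:
  fixes f g :: "'a::topological_space \<Rightarrow> real"
  assumes cont: "continuous_on UNIV f"
    and d: "0 \<le> d" "d < 1"
    and pert: "\<And>w. w \<in> N \<Longrightarrow> \<bar>f w - g w\<bar> \<le> d * f w"
    and min: "minimisers g (closure N) \<noteq> {}"
    and opt: "(MIN v\<in>minimisers g (closure N). \<bar>g x - g v\<bar>) \<le> e"
    and x: "x \<in> N"
  shows "f x \<le> 1 / (1 - d) * ((1 + d) * (INF w\<in>closure N. f w) + e)"
proof -
  \<comment> \<open>Solving the chain for \<open>f w\<close> gives a lower bound that does not depend on \<open>w\<close>.\<close>
  have "((1 - d) * f x - e) / (1 + d) \<le> (INF w\<in>closure N. f w)"
  proof (rule le_cINF_closure[OF cont])
    fix w assume w: "w \<in> N"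
    then have "w \<in> closure N" using closure_subset by blast
    then have "g x \<le> g w + e" by (rule near_optimal_if_Min_gap_le[OF min opt])
    then have "(1 - d) * f x - e \<le> (1 + d) * f w"
      using pert[OF x] pert[OF w] by (simp add: algebra_simps)
    then show "((1 - d) * f x - e) / (1 + d) \<le> f w"
      using d by (simp add: divide_le_eq mult.commute)
  qed (use x in auto)
  then show ?thesis using d by (simp add: field_simps)
qed

theorem corollary3p1:
  fixes T :: "'a::banach \<Rightarrow> 'b::banach" and l :: 'b and u u_t :: 'a
    and N :: "'a set" and J_t :: "'a \<Rightarrow> real"
    and p C_T \<alpha> \<epsilon>_rel \<epsilon>_opt :: real
  assumes "p \<ge> 1"
    and "linear T"
    and "C_T > 0" and "\<alpha> > 0"
    and "\<forall>v. norm (T v) \<le> C_T * norm v"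
    and "\<forall>v. \<alpha> * norm v \<le> norm (T v)"
    and "\<exists>!x. T x = l" and "T u = l"
    and "N \<noteq> {}"
    and "0 \<le> \<epsilon>_rel" and "\<epsilon>_rel < 1" and "\<epsilon>_opt \<ge> 0"
    and "minimisers J_t (closure N) \<noteq> {}"
    and "\<forall>v\<in>N. \<bar>residual_loss T l p v - J_t v\<bar> \<le> \<epsilon>_rel * residual_loss T l p v"
    and "u_t \<in> N"
    and "(MIN v\<in>minimisers J_t (closure N). \<bar>J_t u_t - J_t v\<bar>) \<le> \<epsilon>_opt"
  shows "norm (u_t - u)
          \<le> 1 / \<alpha> * (1 / (1 - \<epsilon>_rel)
              * ((1 + \<epsilon>_rel) * (INF w\<in>closure N. residual_loss T l p w) + \<epsilon>_opt)) powr (1 / p)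
      \<and> 1 / \<alpha> * (1 / (1 - \<epsilon>_rel)
              * ((1 + \<epsilon>_rel) * (INF w\<in>closure N. residual_loss T l p w) + \<epsilon>_opt)) powr (1 / p)
          \<le> 1 / \<alpha> * (1 / (1 - \<epsilon>_rel)
              * (C_T powr p * (1 + \<epsilon>_rel) * (INF w\<in>closure N. norm (u - w) powr p) + \<epsilon>_opt)) powr (1 / p)"
proof -
  define J where "J = residual_loss T l p"
  define I where "I = (INF w\<in>closure N. J w)"
  define E where "E = (INF w\<in>closure N. norm (u - w) powr p)"
  define B where "B = 1 / (1 - \<epsilon>_rel) * ((1 + \<epsilon>_rel) * I + \<epsilon>_opt)"
  have p: "p > 0" using assms(1) by simp
  have ne: "closure N \<noteq> {}" using assms(9) by simp
  have J_nonneg: "J w \<ge> 0" for w by (simp add: J_def residual_loss_def)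
  have bdd: "bdd_below (J ` closure N)" using J_nonneg by (intro bdd_belowI2)
  have I_nonneg: "I \<ge> 0" unfolding I_def using ne J_nonneg by (intro cINF_greatest)

  have "bounded_linear T"
    using assms(2,5) by (auto simp: bounded_linear_def bounded_linear_axioms_def mult.commute)
  then have "continuous_on UNIV J"
    unfolding J_def using p by (rule continuous_on_residual_loss)
  then have "J u_t \<le> B"
    unfolding B_def I_def using assms(10,11,13-16) by (intro quasi_optimal_loss) (auto simp: J_def)
  moreover have "(\<alpha> * norm (u_t - u)) powr p \<le> J u_t"
    unfolding J_def using assms(2,4,6,8) p by (intro residual_loss_ge_error) auto
  ultimately have "((\<alpha> * norm (u_t - u)) powr p) powr (1 / p) \<le> B powr (1 / p)"
    using p by (intro powr_mono2) auto
  then have "\<alpha> * norm (u_t - u) \<le> B powr (1 / p)"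
    using p assms(4) by (simp add: powr_powr)
  then have error: "norm (u_t - u) \<le> 1 / \<alpha> * B powr (1 / p)"
    using assms(4) by (simp add: field_simps)

  have "I / C_T powr p \<le> E"
    unfolding E_def
  proof (rule cINF_greatest[OF ne])
    fix w assume "w \<in> closure N"
    then have "I \<le> J w" unfolding I_def by (rule cINF_lower[OF bdd])
    also have "\<dots> \<le> C_T powr p * norm (u - w) powr p"
      unfolding J_def using assms(2,3,5,8) p by (intro residual_loss_le_error) auto
    finally show "I / C_T powr p \<le> norm (u - w) powr p"
      using assms(3) by (simp add: field_simps)
  qed
  then have "I \<le> C_T powr p * E" using assms(3) by (simp add: field_simps)
  then have "(1 + \<epsilon>_rel) * I \<le> (1 + \<epsilon>_rel) * (C_T powr p * E)"
    using assms(10) by (intro mult_left_mono) auto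
  then have "(1 + \<epsilon>_rel) * I + \<epsilon>_opt \<le> C_T powr p * (1 + \<epsilon>_rel) * E + \<epsilon>_opt"
    by (simp add: ac_simps)
  then have "B \<le> 1 / (1 - \<epsilon>_rel) * (C_T powr p * (1 + \<epsilon>_rel) * E + \<epsilon>_opt)"
    unfolding B_def using assms(11) by (intro mult_left_mono) auto
  moreover have "B \<ge> 0" unfolding B_def using I_nonneg assms(10-12) by simp
  ultimately have "1 / \<alpha> * B powr (1 / p)
      \<le> 1 / \<alpha> * (1 / (1 - \<epsilon>_rel) * (C_T powr p * (1 + \<epsilon>_rel) * E + \<epsilon>_opt)) powr (1 / p)"
    using p assms(4) by (intro mult_left_mono powr_mono2) auto
  with error show ?thesis unfolding B_def I_def E_def J_def by blast
qed

end
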